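(* Let $\mathcal H$ be a complex separable Hilbert space, $H\subset\mathcal H$ a standard subspace, $E$ a projection-valued measure on the Borel $\sigma$-algebra of $\mathbb R$ (acting on $\mathcal H$), and $V:\mathrm{supp}(E)\to\mathcal E(H)$ integrable with respect to $E\otimes1$. Then $$T:=\Bigl(\int dE_\lambda\otimes V(\lambda)\Bigr)\cdot F\in\mathcal B(\mathcal H\otimes\mathcal H)$$ is $S_H$-crossing symmetric.
   Context: Inner products are antilinear in the first and linear in the second argument. A standard subspace $H\subset\mathcal H$ is a closed real linear subspace with $H\cap iH=\{0\}$ and $\overline{H+iH}=\mathcal H$; its Tomita operator is the densely defined closed antilinear involution $S_H:H+iH\to H+iH$, $h_1+ih_2\mapsto h_1-ih_2$, with adjoint given by $\langle v,S_Hw\rangle=\langle w,S_H^*v\rangle$. $\mathcal E(H):=\{V\in\mathcal B(\mathcal H):VH\subset H\}$. $F$ is the tensor flip $F(v\otimes w)=w\otimes v$. Integrability: let $A:\mathrm{supp}(E)\to\mathcal B(\mathcal H)$ be weakly integrable with respect to the measures $\mu_\psi=\langle\psi,E(\cdot)\psi\rangle$ for all $\psi\in\mathcal H$ (i.e. all matrix elements $\lambda\mapsto\langle\psi_2,A(\lambda)\psi_4\rangle$ are $\mu_\psi$-integrable). By polarization, $$\sigma(\psi_1\otimes\psi_2,\psi_3\otimes\psi_4):=\int\langle\psi_1,dE_\lambda\psi_3\rangle\,\langle\psi_2,A(\lambda)\psi_4\rangle$$ is well defined on pure tensors. If $\sigma$ extends to a bounded sesquilinear form on $\mathcal H\otimes\mathcal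 H$, then $A$ is called integrable with respect to $E\otimes1$, and $\int dE_\lambda\otimes A(\lambda)$ denotes the unique bounded operator on $\mathcal H\otimes\mathcal H$ with $\sigma(\cdot,\cdot)=\langle\cdot,(\int dE_\lambda\otimes A(\lambda))\,\cdot\rangle$. Crossing symmetry: for $S=S_H$, $T\in\mathcal B(\mathcal H\otimes\mathcal H)$ is $S$-crossable if there is a (unique) bounded $\mathrm{Cr}_S(T)$ with $\langle\varphi_2\otimes S^*\psi_2,T(S\varphi_1\otimes\psi_1)\rangle=\langle\varphi_1\otimes\varphi_2,\mathrm{Cr}_S(T)(\psi_1\otimes\psi_2)\rangle$ for all $\varphi_1,\psi_1\in\mathrm{dom}(S)$, $\varphi_2,\psi_2\in\mathrm{dom}(S^* )$; it is $S$-crossing symmetric if moreover $\mathrm{Cr}_S(T)=T^*$. *)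

theory Defs
  imports "HOL-Analysis.Analysis"
begin

section \<open>Complex Hilbert spaces and bounded operators\<close>

class complex_inner = real_normed_vector +
  fixes scaleC :: "complex \<Rightarrow> 'a \<Rightarrow> 'a"  (infixr "*\<^sub>C" 75)
    and cinner :: "'a \<Rightarrow> 'a \<Rightarrow> complex"
  assumes scaleC_add_right: "c *\<^sub>C (x + y) = c *\<^sub>C x + c *\<^sub>C y"
    and scaleC_add_left: "(c + d) *\<^sub>C x = c *\<^sub>C x + d *\<^sub>C x"
    and scaleC_scaleC: "c *\<^sub>C (d *\<^sub>C x) = (c * d) *\<^sub>C x"
    and scaleC_of_real: "complex_of_real r *\<^sub>C x = r *\<^sub>R x"
    and cinner_commute: "cinner x y = cnj (cinner y x)"
    and cinner_add_right: "cinner x (y + z) = cinner x y + cinner x z"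
    and cinner_scaleC_right: "cinner x (c *\<^sub>C y) = c * cinner x y"
    and cinner_self: "cinner x x = complex_of_real ((norm x)\<^sup>2)"

class chilbert_space = complex_inner + complete_space

instantiation complex :: chilbert_space
begin

definition scaleC_complex :: "complex \<Rightarrow> complex \<Rightarrow> complex" where
  "scaleC_complex c x = c * x"

definition cinner_complex :: "complex \<Rightarrow> complex \<Rightarrow> complex" where
  "cinner_complex x y = cnj x * y"

instance
proof
  fix x :: complex
  show "cinner x x = complex_of_real ((norm x)\<^sup>2)"
    by (simp only: cinner_complex_def complex_norm_square mult.commute)
qed (simp_all add: scaleC_complex_def cinner_complex_def algebra_simps scaleR_conv_of_real)

end

definition bounded_clinear :: "('a::complex_inner \<Rightarrow> 'b::complex_inner) \<Rightarrow> bool" where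
  "bounded_clinear A \<longleftrightarrow> bounded_linear A \<and> (\<forall>c x. A (c *\<^sub>C x) = c *\<^sub>C A x)"

definition cadjoint :: "('a::complex_inner \<Rightarrow> 'b::complex_inner) \<Rightarrow> 'b \<Rightarrow> 'a" where
  "cadjoint A = (THE B. bounded_clinear B \<and> (\<forall>x y. cinner x (A y) = cinner (B x) y))"

definition bounded_sesquilinear ::
    "('a::complex_inner \<Rightarrow> 'b::complex_inner \<Rightarrow> complex) \<Rightarrow> bool" where
  "bounded_sesquilinear s \<longleftrightarrow> bounded_bilinear s \<and>
     (\<forall>c x y. s (c *\<^sub>C x) y = cnj c * s x y) \<and> (\<forall>c x y. s x (c *\<^sub>C y) = c * s x y)"

section \<open>Hilbert space tensor products\<close>

text \<open>
  The Hilbert space tensor product is characterised, uniquely up to a unitary map that respects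
  pure tensors, as a Hilbert space \<open>'c\<close> with a bilinear map \<open>tens\<close> into it. As
  \<open>c *\<^sub>C tens x y = tens (c *\<^sub>C x) y\<close>, the real span of the pure tensors is also
  their complex span.
\<close>

definition hilbert_tensor ::
    "('a::chilbert_space \<Rightarrow> 'b::chilbert_space \<Rightarrow> 'c::chilbert_space) \<Rightarrow> bool" where
  "hilbert_tensor tens \<longleftrightarrow>
     (\<forall>x x' y. tens (x + x') y = tens x y + tens x' y) \<and>
     (\<forall>x y y'. tens x (y + y') = tens x y + tens x y') \<and>
     (\<forall>c x y. tens (c *\<^sub>C x) y = c *\<^sub>C tens x y) \<and>
     (\<forall>c x y. tens x (c *\<^sub>C y) = c *\<^sub>C tens x y) \<and>
     (\<forall>x y x' y'. cinner (tens x y) (tens x' y') = cinner x x' * cinner y y') \<and>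
     closure (span (range (\<lambda>(x, y). tens x y))) = UNIV"

definition flip :: "('a::chilbert_space \<Rightarrow> 'a \<Rightarrow> 'c::chilbert_space) \<Rightarrow> 'c \<Rightarrow> 'c" where
  "flip tens = (THE F. bounded_clinear F \<and> (\<forall>v w. F (tens v w) = tens w v))"

section \<open>Standard subspaces and Tomita operators\<close>

definition complex_sum :: "'a::complex_inner set \<Rightarrow> 'a set" where
  "complex_sum H = {h + \<i> *\<^sub>C k | h k. h \<in> H \<and> k \<in> H}"

definition standard_subspace :: "'a::chilbert_space set \<Rightarrow> bool" where
  "standard_subspace H \<longleftrightarrow> subspace H \<and> closed H \<and>
     H \<inter> (\<lambda>h. \<i> *\<^sub>C h) ` H = {0} \<and> closure (complex_sum H) = UNIV"

text \<open>
  An unbounded operator is given by its domain and a total function of which only the values on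
  the domain matter. The Tomita operator of \<open>H\<close> is given by \<open>complex_sum H\<close> and \<open>tomita H\<close>.
\<close>

definition tomita :: "'a::chilbert_space set \<Rightarrow> 'a \<Rightarrow> 'a" where
  "tomita H v = (THE w. \<exists>h\<in>H. \<exists>k\<in>H. v = h + \<i> *\<^sub>C k \<and> w = h - \<i> *\<^sub>C k)"

definition antilinear_adj_dom :: "'a::chilbert_space set \<Rightarrow> ('a \<Rightarrow> 'a) \<Rightarrow> 'a set" where
  "antilinear_adj_dom D S = {v. \<exists>u. \<forall>w\<in>D. cinner v (S w) = cinner w u}"

definition antilinear_adj :: "'a::chilbert_space set \<Rightarrow> ('a \<Rightarrow> 'a) \<Rightarrow> 'a \<Rightarrow> 'a" where
  "antilinear_adj D S v = (THE u. \<forall>w\<in>D. cinner v (S w) = cinner w u)"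

definition subspace_endos :: "'a::chilbert_space set \<Rightarrow> ('a \<Rightarrow> 'a) set" where
  "subspace_endos H = {V. bounded_clinear V \<and> V ` H \<subseteq> H}"

section \<open>Projection-valued measures\<close>

definition orthogonal_projection :: "('a::chilbert_space \<Rightarrow> 'a) \<Rightarrow> bool" where
  "orthogonal_projection P \<longleftrightarrow> bounded_clinear P \<and> P \<circ> P = P \<and>
     (\<forall>x y. cinner x (P y) = cinner (P x) y)"

definition projection_valued_measure :: "(real set \<Rightarrow> 'a::chilbert_space \<Rightarrow> 'a) \<Rightarrow> bool" where
  "projection_valued_measure E \<longleftrightarrow>
     (\<forall>B\<in>sets borel. orthogonal_projection (E B)) \<and>
     E {} = (\<lambda>_. 0) \<and> E UNIV = id \<and>
     (\<forall>B\<in>sets borel. \<forall>C\<in>sets borel. E (B \<inter> C) = E B \<circ> E C) \<and>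
     (\<forall>B :: nat \<Rightarrow> real set. range B \<subseteq> sets borel \<longrightarrow> disjoint_family B \<longrightarrow>
        (\<forall>\<psi>. (\<lambda>n. E (B n) \<psi>) sums E (\<Union>n. B n) \<psi>))"

definition pvm_support :: "(real set \<Rightarrow> 'a::chilbert_space \<Rightarrow> 'a) \<Rightarrow> real set" where
  "pvm_support E = {x. \<forall>U. open U \<longrightarrow> x \<in> U \<longrightarrow> E U \<noteq> (\<lambda>_. 0)}"

definition pvm_measure :: "(real set \<Rightarrow> 'a::chilbert_space \<Rightarrow> 'a) \<Rightarrow> 'a \<Rightarrow> real measure" where
  "pvm_measure E \<psi> =
     measure_of UNIV (sets borel) (\<lambda>B. ennreal (Re (cinner \<psi> (E B \<psi>))))"

text \<open>
  The integral of a function on the support against the complex measure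
  \<open>cinner \<phi> (E B \<psi>)\<close>, which by polarization is the sum over \<open>k < 4\<close> of \<open>\<i> ^ k / 4\<close> times
  the measure of the vector \<open>\<psi> + \<i> ^ k *\<^sub>C \<phi>\<close> (the form is antilinear in \<open>\<phi>\<close>).
\<close>

definition polarized_integral ::
    "(real set \<Rightarrow> 'a::chilbert_space \<Rightarrow> 'a) \<Rightarrow> 'a \<Rightarrow> 'a \<Rightarrow> (real \<Rightarrow> complex) \<Rightarrow> complex" where
  "polarized_integral E \<phi> \<psi> f =
     (\<Sum>k<4. \<i> ^ k * (LINT x:pvm_support E|pvm_measure E (\<psi> + \<i> ^ k *\<^sub>C \<phi>). f x)) / 4"

text \<open>
  Operator-valued functions on the support are total functions on the reals; their values
  outside the support are irrelevant.
\<close>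

definition weakly_integrable ::
    "(real set \<Rightarrow> 'a::chilbert_space \<Rightarrow> 'a) \<Rightarrow> (real \<Rightarrow> 'a \<Rightarrow> 'a) \<Rightarrow> bool" where
  "weakly_integrable E A \<longleftrightarrow>
     (\<forall>\<psi> \<psi>2 \<psi>4. set_integrable (pvm_measure E \<psi>) (pvm_support E) (\<lambda>x. cinner \<psi>2 (A x \<psi>4)))"

definition extends_tensor_form ::
    "('a::chilbert_space \<Rightarrow> 'a \<Rightarrow> 'c::chilbert_space) \<Rightarrow> (real set \<Rightarrow> 'a \<Rightarrow> 'a) \<Rightarrow>
     (real \<Rightarrow> 'a \<Rightarrow> 'a) \<Rightarrow> ('c \<Rightarrow> 'c \<Rightarrow> complex) \<Rightarrow> bool" where
  "extends_tensor_form tens E A \<sigma> \<longleftrightarrow>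
     (\<forall>\<psi>1 \<psi>2 \<psi>3 \<psi>4. \<sigma> (tens \<psi>1 \<psi>2) (tens \<psi>3 \<psi>4) =
        polarized_integral E \<psi>1 \<psi>3 (\<lambda>x. cinner \<psi>2 (A x \<psi>4)))"

definition pvm_integrable ::
    "('a::chilbert_space \<Rightarrow> 'a \<Rightarrow> 'c::chilbert_space) \<Rightarrow> (real set \<Rightarrow> 'a \<Rightarrow> 'a) \<Rightarrow>
     (real \<Rightarrow> 'a \<Rightarrow> 'a) \<Rightarrow> bool" where
  "pvm_integrable tens E A \<longleftrightarrow> weakly_integrable E A \<and>
     (\<exists>\<sigma>. bounded_sesquilinear \<sigma> \<and> extends_tensor_form tens E A \<sigma>)"

definition pvm_integral ::
    "('a::chilbert_space \<Rightarrow> 'a \<Rightarrow> 'c::chilbert_space) \<Rightarrow> (real set \<Rightarrow> 'a \<Rightarrow> 'a) \<Rightarrow>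
     (real \<Rightarrow> 'a \<Rightarrow> 'a) \<Rightarrow> 'c \<Rightarrow> 'c" where
  "pvm_integral tens E A = (THE T. bounded_clinear T \<and>
     (\<exists>\<sigma>. bounded_sesquilinear \<sigma> \<and> extends_tensor_form tens E A \<sigma> \<and>
       (\<forall>x y. \<sigma> x y = cinner x (T y))))"

section \<open>Crossing symmetry\<close>

definition is_crossing ::
    "('a::chilbert_space \<Rightarrow> 'a \<Rightarrow> 'c::chilbert_space) \<Rightarrow> 'a set \<Rightarrow> ('a \<Rightarrow> 'a) \<Rightarrow>
     ('c \<Rightarrow> 'c) \<Rightarrow> ('c \<Rightarrow> 'c) \<Rightarrow> bool" where
  "is_crossing tens D S T C \<longleftrightarrow> bounded_clinear C \<and>
     (\<forall>\<phi>1\<in>D. \<forall>\<psi>1\<in>D. \<forall>\<phi>2\<in>antilinear_adj_dom D S. \<forall>\<psi>2\<in>antilinear_adj_dom D S.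
        cinner (tens \<phi>2 (antilinear_adj D S \<psi>2)) (T (tens (S \<phi>1) \<psi>1)) =
        cinner (tens \<phi>1 \<phi>2) (C (tens \<psi>1 \<psi>2)))"

definition crossable ::
    "('a::chilbert_space \<Rightarrow> 'a \<Rightarrow> 'c::chilbert_space) \<Rightarrow> 'a set \<Rightarrow> ('a \<Rightarrow> 'a) \<Rightarrow>
     ('c \<Rightarrow> 'c) \<Rightarrow> bool" where
  "crossable tens D S T \<longleftrightarrow> bounded_clinear T \<and> (\<exists>!C. is_crossing tens D S T C)"

definition crossing_map ::
    "('a::chilbert_space \<Rightarrow> 'a \<Rightarrow> 'c::chilbert_space) \<Rightarrow> 'a set \<Rightarrow> ('a \<Rightarrow> 'a) \<Rightarrow>
     ('c \<Rightarrow> 'c) \<Rightarrow> 'c \<Rightarrow> 'c" where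
  "crossing_map tens D S T = (THE C. is_crossing tens D S T C)"

definition crossing_symmetric ::
    "('a::chilbert_space \<Rightarrow> 'a \<Rightarrow> 'c::chilbert_space) \<Rightarrow> 'a set \<Rightarrow> ('a \<Rightarrow> 'a) \<Rightarrow>
     ('c \<Rightarrow> 'c) \<Rightarrow> bool" where
  "crossing_symmetric tens D S T \<longleftrightarrow>
     crossable tens D S T \<and> crossing_map tens D S T = cadjoint T"

end

theory Submission
  imports Defs
begin

text \<open>
  Each \<open>V l\<close> maps \<open>H\<close> into itself and hence commutes with the Tomita operator \<open>S\<close> on its domain.
  Therefore \<open>cinner (S\<^sup>* \<psi>\<^sub>2) (V l (S \<phi>\<^sub>1)) = cnj (cinner \<psi>\<^sub>2 (V l \<phi>\<^sub>1))\<close>, and as the complex measures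
  of a projection-valued measure are conjugated by exchanging their two vectors, the crossed matrix
  elements of \<open>T\<close> are the complex conjugates of matrix elements of \<open>T\<close>, i.e. matrix elements of
  its adjoint. An operator is determined by these matrix elements because the domain of \<open>S\<^sup>*\<close> is
  dense: a vector orthogonal to it lies in \<open>H \<inter> \<i> H = {0}\<close>.
\<close>

section \<open>Complex inner product spaces\<close>

lemma cinner_add_left: "cinner (x + y) z = cinner x z + cinner y (z::'a::complex_inner)"
  by (subst (1 2 3) cinner_commute) (simp add: cinner_add_right)

lemma cinner_scaleC_left: "cinner (c *\<^sub>C x) y = cnj c * cinner x (y::'a::complex_inner)"
  by (subst (1 2) cinner_commute) (simp add: cinner_scaleC_right)

lemma cinner_scaleR_right: "cinner x (r *\<^sub>R y) = r *\<^sub>R cinner x (y::'a::complex_inner)"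
  by (simp add: scaleC_of_real[of r y, symmetric] cinner_scaleC_right scaleR_conv_of_real)

lemma cinner_scaleR_left: "cinner (r *\<^sub>R x) y = r *\<^sub>R cinner x (y::'a::complex_inner)"
  by (simp add: scaleC_of_real[of r x, symmetric] cinner_scaleC_left scaleR_conv_of_real)

lemma scaleC_one [simp]: "1 *\<^sub>C x = (x::'a::complex_inner)"
  using scaleC_of_real[of 1 x] by simp

lemma scaleC_minus_one: "(-1) *\<^sub>C x = - (x::'a::complex_inner)"
  using scaleC_of_real[of "-1" x] by simp

lemma scaleC_zero_left [simp]: "0 *\<^sub>C x = (0::'a::complex_inner)"
  using scaleC_of_real[of 0 x] by simp

lemma scaleC_diff_right: "c *\<^sub>C (x - y) = c *\<^sub>C x - c *\<^sub>C (y::'a::complex_inner)"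
  using scaleC_add_right[of c "x - y" y] by (simp add: algebra_simps)

lemma scaleC_minus_right: "c *\<^sub>C (- x) = - (c *\<^sub>C (x::'a::complex_inner))"
  using scaleC_diff_right[of c x x] scaleC_diff_right[of c "x - x" x] by simp

lemma scaleC_scaleR: "c *\<^sub>C (r *\<^sub>R x) = r *\<^sub>R (c *\<^sub>C (x::'a::complex_inner))"
  by (simp only: scaleC_of_real[symmetric] scaleC_scaleC mult.commute)

lemma norm_eq_if_cinner_eq:
  fixes x :: "'a::complex_inner" and y :: "'b::complex_inner"
  assumes "cinner x x = cinner y y"
  shows "norm x = norm y"
proof -
  have "(norm x)\<^sup>2 = (norm y)\<^sup>2"
    using assms unfolding cinner_self of_real_eq_iff .
  then show ?thesis by (rule power2_eq_imp_eq) simp_all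
qed

text \<open>Cauchy-Schwarz: for \<open>c = - cinner x y / (norm x)\<^sup>2\<close> the vector
  \<open>y + c *\<^sub>C x\<close> is the component of \<open>y\<close> orthogonal to
  \<open>x\<close>, and the claim says that its squared norm is nonnegative.\<close>

lemma norm_cinner_le: "norm (cinner x y) \<le> norm x * norm (y::'a::complex_inner)"
proof (cases "x = 0")
  case True
  then have "cinner x y = 0"
    using cinner_scaleC_left[of 0 x y] by simp
  with True show ?thesis by simp
next
  case False
  define a where "a = cinner x y"
  define n where "n = (norm x)\<^sup>2"
  have n: "n > 0" using False by (simp add: n_def)
  define c where "c = - (a / complex_of_real n)"
  have ax: "cinner y x = cnj a" unfolding a_def by (rule cinner_commute)
  have cc: "cnj c = - (cnj a / complex_of_real n)" by (simp add: c_def)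
  have "complex_of_real ((norm (y + c *\<^sub>C x))\<^sup>2) =
      complex_of_real ((norm y)\<^sup>2) + c * cnj a + cnj c * a + c * cnj c * complex_of_real n"
    unfolding cinner_self[symmetric] n_def
    by (simp add: cinner_add_right cinner_add_left cinner_scaleC_left cinner_scaleC_right ax
        a_def[symmetric] algebra_simps)
  also have "\<dots> = complex_of_real ((norm y)\<^sup>2) - a * cnj a / complex_of_real n"
    unfolding cc c_def using n by (simp add: field_simps)
  also have "\<dots> = complex_of_real ((norm y)\<^sup>2 - (norm a)\<^sup>2 / n)"
    by (simp only: complex_norm_square of_real_diff of_real_divide)
  finally have "(norm (y + c *\<^sub>C x))\<^sup>2 = (norm y)\<^sup>2 - (norm a)\<^sup>2 / n"
    using of_real_eq_iff by blast
  then have "(norm a)\<^sup>2 / n \<le> (norm y)\<^sup>2"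
    using zero_le_power2[of "norm (y + c *\<^sub>C x)"] by linarith
  then have "(norm a)\<^sup>2 \<le> (norm x * norm y)\<^sup>2"
    using n by (simp add: pos_divide_le_eq n_def power_mult_distrib mult.commute)
  then show ?thesis unfolding a_def
    by (rule power2_le_imp_le) simp
qed

lemma bounded_bilinear_cinner:
  "bounded_bilinear (cinner :: 'a::complex_inner \<Rightarrow> 'a \<Rightarrow> complex)"
  by (unfold_locales; (rule cinner_add_left cinner_add_right cinner_scaleR_left
        cinner_scaleR_right exI[of _ 1] allI)?) (simp add: norm_cinner_le)

interpretation cinner: bounded_bilinear "cinner :: 'a::complex_inner \<Rightarrow> 'a \<Rightarrow> complex"
  by (rule bounded_bilinear_cinner)

lemma cinner_eq_zero_iff: "cinner x x = 0 \<longleftrightarrow> x = (0::'a::complex_inner)"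
  by (simp add: cinner_self)

lemma cinner_eq_right:
  fixes y z :: "'a::complex_inner"
  assumes "\<And>x. cinner x y = cinner x z"
  shows "y = z"
  using assms[of "y - z"] cinner_eq_zero_iff[of "y - z"] by (simp add: cinner.diff_right)

lemma cinner_eq_left:
  fixes y z :: "'a::complex_inner"
  assumes "\<And>x. cinner y x = cinner z x"
  shows "y = z"
  by (rule cinner_eq_right) (metis assms cinner_commute)

lemma norm_scaleC: "norm (c *\<^sub>C x) = cmod c * norm (x::'a::complex_inner)"
proof -
  have "complex_of_real ((norm (c *\<^sub>C x))\<^sup>2) = complex_of_real ((cmod c * norm x)\<^sup>2)"
    unfolding cinner_self[symmetric] cinner_scaleC_left cinner_scaleC_right
    by (simp add: cinner_self power_mult_distrib complex_norm_square[of c, symmetric, simplified]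
        mult.assoc[symmetric] mult.commute[of "cnj c"])
  then have "(norm (c *\<^sub>C x))\<^sup>2 = (cmod c * norm x)\<^sup>2"
    using of_real_eq_iff by blast
  then show ?thesis by (rule power2_eq_imp_eq) simp_all
qed

lemma bounded_linear_scaleC: "bounded_linear (\<lambda>x::'a::complex_inner. c *\<^sub>C x)"
  by (rule bounded_linear_intro[where K = "cmod c"])
    (simp_all add: scaleC_add_right scaleC_scaleR norm_scaleC)

lemma power2_norm_add:
  "(norm (x + y))\<^sup>2 = (norm x)\<^sup>2 + 2 * Re (cinner x y) + (norm (y::'a::complex_inner))\<^sup>2"
proof -
  have "complex_of_real ((norm (x + y))\<^sup>2) =
      cinner x x + cinner x y + cnj (cinner x y) + cinner y y"
    unfolding cinner_self[symmetric]
    by (simp add: cinner_add_left cinner_add_right cinner_commute[symmetric] add.assoc)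
  then have "Re (complex_of_real ((norm (x + y))\<^sup>2)) =
      Re (cinner x x + cinner x y + cnj (cinner x y) + cinner y y)" by (rule arg_cong)
  then show ?thesis by (simp add: cinner_self)
qed

lemma parallelogram_law:
  fixes x y :: "'a::complex_inner"
  shows "(norm (x - y))\<^sup>2 = 2 * (norm x)\<^sup>2 + 2 * (norm y)\<^sup>2 - (norm (x + y))\<^sup>2"
  using power2_norm_add[of x y] power2_norm_add[of x "- y"] by (simp add: cinner.minus_right)

section \<open>Projection onto closed real subspaces, Riesz representation\<close>

text \<open>The parallelogram law makes a minimizing sequence Cauchy; completeness then gives a
  limit, which stays in the closed set \<open>M\<close>.\<close>

lemma closest_point_in_subspace:
  fixes M :: "'a::chilbert_space set"
  assumes M: "subspace M" "closed M"
  obtains p where "p \<in> M" "\<And>m. m \<in> M \<Longrightarrow> dist x p \<le> dist x m"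
proof -
  have ne: "M \<noteq> {}" using subspace_0[OF M(1)] by blast
  define d where "d = infdist x M"
  have d0: "0 \<le> d" by (simp add: d_def infdist_nonneg)
  have d: "d \<le> dist x m" if "m \<in> M" for m using that by (simp add: d_def infdist_le)
  have "\<exists>m\<in>M. dist x m < d + inverse (real (Suc n))" for n
  proof (rule ccontr)
    assume "\<not> ?thesis"
    then have "d + inverse (real (Suc n)) \<le> d"
      unfolding d_def infdist_notempty[OF ne] by (intro cINF_greatest ne) (auto simp: not_less)
    then show False by simp
  qed
  then obtain s where s: "\<And>n. s n \<in> M" "\<And>n. dist x (s n) < d + inverse (real (Suc n))"
    by metis
  have lim: "(\<lambda>n. dist x (s n)) \<longlonglongrightarrow> d"
  proof (rule tendsto_sandwich)
    show "(\<lambda>n. d) \<longlonglongrightarrow> d" by simp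
    show "(\<lambda>n. d + inverse (real (Suc n))) \<longlonglongrightarrow> d"
      using tendsto_add[OF tendsto_const LIMSEQ_inverse_real_of_nat, of d] by simp
  qed (use d s in \<open>auto intro!: always_eventually less_imp_le simp del: of_nat_Suc\<close>)
  have par: "(dist (s m) (s n))\<^sup>2 \<le> 2 * ((dist x (s m))\<^sup>2 - d\<^sup>2) + 2 * ((dist x (s n))\<^sup>2 - d\<^sup>2)"
    for m n
  proof -
    \<comment> \<open>The midpoint of two members of \<open>M\<close> cannot be closer to
      \<open>x\<close> than \<open>d\<close>, which bounds the sum term of the parallelogram law
      from below.\<close>
    have "(1/2) *\<^sub>R (s m + s n) \<in> M"
      using s(1) M(1) by (simp add: subspace_add subspace_scale)
    then have "d \<le> dist x ((1/2) *\<^sub>R (s m + s n))" by (rule d)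
    also have "x - (1/2) *\<^sub>R (s m + s n) = (1/2) *\<^sub>R ((x - s m) + (x - s n))"
      by (simp add: algebra_simps) (metis scaleR_half_double scaleR_add_right)
    then have "dist x ((1/2) *\<^sub>R (s m + s n)) = norm ((x - s m) + (x - s n)) / 2"
      by (simp add: dist_norm)
    finally have "(2 * d)\<^sup>2 \<le> (norm ((x - s m) + (x - s n)))\<^sup>2"
      using d0 by (intro power_mono) auto
    then show ?thesis
      using parallelogram_law[of "x - s m" "x - s n"]
      by (simp add: dist_norm norm_minus_commute power_mult_distrib)
  qed
  have "Cauchy s"
    unfolding Cauchy_def
  proof (intro allI impI)
    fix e :: real assume e: "0 < e"
    have "(\<lambda>n. (dist x (s n))\<^sup>2 - d\<^sup>2) \<longlonglongrightarrow> d\<^sup>2 - d\<^sup>2"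
      by (intro tendsto_intros lim)
    then have "\<forall>\<^sub>F n in sequentially. (dist x (s n))\<^sup>2 - d\<^sup>2 < e\<^sup>2 / 4"
      by (rule order_tendstoD) (use e in simp)
    then obtain N where N: "\<And>n. n \<ge> N \<Longrightarrow> (dist x (s n))\<^sup>2 - d\<^sup>2 < e\<^sup>2 / 4"
      unfolding eventually_sequentially by blast
    show "\<exists>N. \<forall>m\<ge>N. \<forall>n\<ge>N. dist (s m) (s n) < e"
    proof (intro exI allI impI)
      fix m n assume mn: "N \<le> m" "N \<le> n"
      have "(dist (s m) (s n))\<^sup>2 < e\<^sup>2"
        using par[of m n] N[OF mn(1)] N[OF mn(2)] by argo
      then show "dist (s m) (s n) < e"
        using e by (simp add: power2_less_imp_less)
    qed
  qed
  then obtain p where p: "s \<longlonglongrightarrow> p"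
    using Cauchy_convergent convergent_def by blast
  show thesis
  proof
    show "p \<in> M" using closed_sequentially[OF M(2)] s(1) p by blast
    have "(\<lambda>n. dist x (s n)) \<longlonglongrightarrow> dist x p" by (intro tendsto_intros p)
    then have "dist x p = d" using lim LIMSEQ_unique by blast
    then show "dist x p \<le> dist x m" if "m \<in> M" for m using d that by simp
  qed
qed

text \<open>A closest point cannot be improved by moving along \<open>m\<close>. As \<open>M\<close>
  is only a real subspace, real multiples of \<open>m\<close> are available and only the real part
  of the inner product is forced to vanish.\<close>

lemma real_orthogonal_projection:
  fixes M :: "'a::chilbert_space set"
  assumes M: "subspace M" "closed M"
  obtains p where "p \<in> M" "\<And>m. m \<in> M \<Longrightarrow> Re (cinner (x - p) m) = 0"
proof -
  obtain p where p: "p \<in> M" "\<And>m. m \<in> M \<Longrightarrow> dist x p \<le> dist x m"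
    using closest_point_in_subspace[OF M] by blast
  have "Re (cinner (x - p) m) = 0" if m: "m \<in> M" for m
  proof (rule ccontr)
    define r where "r = Re (cinner (x - p) m)"
    assume "Re (cinner (x - p) m) \<noteq> 0"
    then have r: "r \<noteq> 0" by (simp add: r_def)
    then have "m \<noteq> 0" by (auto simp: r_def cinner.zero_right)
    then have n: "(norm m)\<^sup>2 > 0" by simp
    \<comment> \<open>This \<open>t\<close> minimizes the quadratic polynomial
      \<open>(norm (x - p - t *\<^sub>R m))\<^sup>2\<close>, which there lies
      \<open>r\<^sup>2 / (norm m)\<^sup>2\<close> below its value at 0.\<close>
    define t where "t = r / (norm m)\<^sup>2"
    have "p + t *\<^sub>R m \<in> M" using p(1) m M(1) by (simp add: subspace_add subspace_scale)
    then have "(dist x p)\<^sup>2 \<le> (dist x (p + t *\<^sub>R m))\<^sup>2" using p(2) by (intro power_mono) auto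
    also have "dist x (p + t *\<^sub>R m) = norm ((x - p) + (- t) *\<^sub>R m)"
      by (simp add: dist_norm algebra_simps)
    also have "\<dots>\<^sup>2 = (dist x p)\<^sup>2 - 2 * t * r + t\<^sup>2 * (norm m)\<^sup>2"
      unfolding power2_norm_add by (simp add: cinner.scaleR_right cinner.minus_right r_def dist_norm power_mult_distrib)
    finally have "2 * t * r \<le> t\<^sup>2 * (norm m)\<^sup>2" by simp
    moreover have "t * (norm m)\<^sup>2 = r" using n by (simp add: t_def)
    then have "t\<^sup>2 * (norm m)\<^sup>2 = t * r" by (simp add: power2_eq_square)
    moreover have "t * r > 0" using n r by (simp add: t_def power2_eq_square[symmetric])
    ultimately show False by linarith
  qed
  with p(1) that show thesis by blast
qed

lemma orthogonal_projection_complex: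
  fixes M :: "'a::chilbert_space set"
  assumes M: "subspace M" "closed M" "\<And>c m. m \<in> M \<Longrightarrow> c *\<^sub>C m \<in> M"
  obtains p where "p \<in> M" "\<And>m. m \<in> M \<Longrightarrow> cinner (x - p) m = 0"
proof -
  obtain p where p: "p \<in> M" "\<And>m. m \<in> M \<Longrightarrow> Re (cinner (x - p) m) = 0"
    using real_orthogonal_projection[OF M(1,2)] by blast
  \<comment> \<open>Testing with \<open>\<i> *\<^sub>C m\<close> as well turns the imaginary part
    into a real part.\<close>
  have "cinner (x - p) m = 0" if "m \<in> M" for m
    using p(2)[OF that] p(2)[OF M(3)[OF that, of "\<i>"]]
    by (simp add: cinner_scaleC_right complex_eq_iff)
  with p(1) that show thesis by blast
qed

lemma subspace_closure:
  fixes M :: "'a::real_normed_vector set"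
  assumes "subspace M"
  shows "subspace (closure M)"
proof (rule subspaceI)
  show "0 \<in> closure M" using subspace_0[OF assms] closure_subset by blast
  show "x + y \<in> closure M" if xy: "x \<in> closure M" "y \<in> closure M" for x y
  proof -
    obtain s t where "\<forall>n. s n \<in> M" "s \<longlonglongrightarrow> x" "\<forall>n. t n \<in> M" "t \<longlonglongrightarrow> y"
      using xy unfolding closure_sequential by blast
    then show ?thesis unfolding closure_sequential
      by (intro exI[of _ "\<lambda>n. s n + t n"]) (auto intro: tendsto_add subspace_add[OF assms])
  qed
  show "c *\<^sub>R x \<in> closure M" if x: "x \<in> closure M" for c x
  proof -
    obtain s where "\<forall>n. s n \<in> M" "s \<longlonglongrightarrow> x"
      using x unfolding closure_sequential by blast
    then show ?thesis unfolding closure_sequential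
      by (intro exI[of _ "\<lambda>n. c *\<^sub>R s n"])
        (auto intro: tendsto_scaleR subspace_scale[OF assms])
  qed
qed

text \<open>The difference between \<open>x\<close> and its projection onto \<open>closure M\<close>
  is orthogonal to \<open>M\<close>, hence zero.\<close>

lemma dense_if_orthogonal_trivial:
  fixes M :: "'a::chilbert_space set"
  assumes M: "subspace M" "\<And>c m. m \<in> M \<Longrightarrow> c *\<^sub>C m \<in> M"
    and triv: "\<And>x. (\<And>m. m \<in> M \<Longrightarrow> cinner x m = 0) \<Longrightarrow> x = 0"
  shows "closure M = UNIV"
proof -
  have c: "c *\<^sub>C m \<in> closure M" if "m \<in> closure M" for c m
  proof -
    have "(\<lambda>x. c *\<^sub>C x) ` closure M \<subseteq> closure M"
      by (rule image_closure_subset)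
        (use M(2) closure_subset in \<open>auto intro!: linear_continuous_on bounded_linear_scaleC\<close>)
    with that show ?thesis by blast
  qed
  have "x \<in> closure M" for x
  proof -
    obtain p where p: "p \<in> closure M" "\<And>m. m \<in> closure M \<Longrightarrow> cinner (x - p) m = 0"
      using orthogonal_projection_complex[OF subspace_closure[OF M(1)] closed_closure c] by blast
    have "x - p = 0" using p(2) closure_subset by (intro triv) blast
    with p(1) show ?thesis by simp
  qed
  then show ?thesis by blast
qed

lemma riesz_representation:
  fixes f :: "'a::chilbert_space \<Rightarrow> complex"
  assumes bl: "bounded_linear f" and c: "\<And>c x. f (c *\<^sub>C x) = c * f x"
  shows "\<exists>z. \<forall>x. f x = cinner z x"
proof (cases "\<forall>x. f x = 0")
  case True
  then show ?thesis by (intro exI[of _ 0]) (simp add: cinner.zero_left)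
next
  case False
  then obtain x0 where x0: "f x0 \<noteq> 0" by blast
  interpret f: bounded_linear f by fact
  define M where "M = {x. f x = 0}"
  have "subspace M" by (simp add: M_def subspace_def f.add f.scaleR f.zero)
  moreover have "closed M" unfolding M_def
    by (intro closed_Collect_eq continuous_intros linear_continuous_on bl)
  moreover have "c *\<^sub>C m \<in> M" if "m \<in> M" for c m using that by (simp add: M_def c)
  ultimately obtain p where p: "p \<in> M" "\<And>m. m \<in> M \<Longrightarrow> cinner (x0 - p) m = 0"
    using orthogonal_projection_complex by blast
  define u where "u = x0 - p"
  have fu: "f u \<noteq> 0" using p(1) x0 by (simp add: u_def f.diff M_def)
  then have u: "u \<noteq> 0" using f.zero by auto
  \<comment> \<open>The orthogonal complement of the kernel is the line through \<open>u\<close>.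
    The coefficient is scaled so that both sides agree at \<open>u\<close>, and conjugated because
    \<open>cinner\<close> is antilinear on the left.\<close>
  have "f x = cinner ((cnj (f u) / complex_of_real ((norm u)\<^sup>2)) *\<^sub>C u) x" for x
  proof -
    have "x - (f x / f u) *\<^sub>C u \<in> M" using fu by (simp add: M_def f.diff c)
    then have "cinner u (x - (f x / f u) *\<^sub>C u) = 0" using p(2) by (simp add: u_def)
    then have "cinner u x = f x / f u * complex_of_real ((norm u)\<^sup>2)"
      by (simp add: cinner.diff_right cinner_scaleC_right cinner_self)
    then show ?thesis using fu u by (simp add: cinner_scaleC_left)
  qed
  then show ?thesis by blast
qed

section \<open>Bounded sesquilinear forms and adjoints\<close>

lemma bounded_sesquilinear_representation:
  fixes s :: "'a::chilbert_space \<Rightarrow> 'b::complex_inner \<Rightarrow> complex"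
  assumes "bounded_sesquilinear s"
  shows "\<exists>T. bounded_clinear T \<and> (\<forall>x y. s x y = cinner x (T y))"
proof -
  interpret s: bounded_bilinear s using assms by (simp add: bounded_sesquilinear_def)
  have cl: "s (c *\<^sub>C x) y = cnj c * s x y" and cr: "s x (c *\<^sub>C y) = c * s x y" for c x y
    using assms by (simp_all add: bounded_sesquilinear_def)
  \<comment> \<open>The form is antilinear in \<open>x\<close>, so it is its conjugate to which the
    Riesz theorem applies.\<close>
  have "\<exists>z. \<forall>x. cnj (s x y) = cinner z x" for y
  proof (rule riesz_representation)
    show "bounded_linear (\<lambda>x. cnj (s x y))"
      by (intro bounded_linear_compose[OF bounded_linear_cnj] s.bounded_linear_left)
  qed (simp add: cl)
  then obtain T where "\<And>y x. cnj (s x y) = cinner (T y) x" by metis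
  then have T: "s x y = cinner x (T y)" for x y by (metis cinner_commute complex_cnj_cnj)
  obtain K where K: "K \<ge> 0" "\<And>x y. norm (s x y) \<le> norm x * norm y * K"
    using s.nonneg_bounded by blast
  have "bounded_clinear T"
    unfolding bounded_clinear_def
  proof (intro conjI allI)
    show "bounded_linear T"
    proof (rule bounded_linear_intro)
      show "T (x + y) = T x + T y" for x y
        by (rule cinner_eq_right) (simp add: T[symmetric] cinner_add_right s.add_right)
      show "T (r *\<^sub>R x) = r *\<^sub>R T x" for r x
        by (rule cinner_eq_right) (simp add: T[symmetric] cinner_scaleR_right s.scaleR_right)
      show "norm (T x) \<le> norm x * K" for x
      proof (cases "T x = 0")
        case False
        \<comment> \<open>Testing the form with \<open>T x\<close> itself allows one factor
          \<open>norm (T x)\<close> to be cancelled.\<close>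
        have "(norm (T x))\<^sup>2 = norm (s (T x) x)" by (simp add: T cinner_self norm_power)
        also have "\<dots> \<le> norm (T x) * norm x * K" by (rule K)
        finally show ?thesis using False by (simp add: power2_eq_square mult.assoc)
      qed (use K in simp)
    qed
    show "T (c *\<^sub>C x) = c *\<^sub>C T x" for c x
      by (rule cinner_eq_right) (simp add: T[symmetric] cinner_scaleC_right cr)
  qed
  with T show ?thesis by blast
qed

lemma cadjoint_works:
  fixes A :: "'a::chilbert_space \<Rightarrow> 'b::chilbert_space"
  assumes "bounded_clinear A"
  shows "bounded_clinear (cadjoint A)" "cinner x (A y) = cinner (cadjoint A x) y"
proof -
  have bl: "bounded_linear A" using assms by (simp add: bounded_clinear_def)
  have "bounded_sesquilinear (\<lambda>y x. cinner (A y) x)"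
    unfolding bounded_sesquilinear_def
    using assms by (auto simp: bounded_clinear_def cinner_scaleC_left cinner_scaleC_right
        intro!: cinner.comp[OF bl bounded_linear_ident])
  then obtain B where B: "bounded_clinear B" "\<And>y x. cinner (A y) x = cinner y (B x)"
    using bounded_sesquilinear_representation by blast
  have adj: "cinner x (A y) = cinner (B x) y" for x y
    by (subst (1 2) cinner_commute) (simp add: B(2))
  have "\<exists>!B. bounded_clinear B \<and> (\<forall>x y. cinner x (A y) = cinner (B x) y)"
  proof (rule ex1I)
    show "bounded_clinear B \<and> (\<forall>x y. cinner x (A y) = cinner (B x) y)"
      by (intro conjI allI B(1) adj)
    show "B' = B" if "bounded_clinear B' \<and> (\<forall>x y. cinner x (A y) = cinner (B' x) y)" for B'
    proof (rule ext, rule cinner_eq_left)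
      show "cinner (B' x) y = cinner (B x) y" for x y
        using that by (simp add: adj[symmetric])
    qed
  qed
  from theI'[OF this] show "bounded_clinear (cadjoint A)" "cinner x (A y) = cinner (cadjoint A x) y"
    unfolding cadjoint_def by blast+
qed

lemma bounded_clinear_compose:
  assumes "bounded_clinear A" "bounded_clinear B"
  shows "bounded_clinear (A \<circ> B)"
  using assms by (auto simp: bounded_clinear_def o_def intro: bounded_linear_compose)

section \<open>Operators on the tensor product\<close>

text \<open>Since inner products are preserved, the closure of the span of the pairs
  \<open>(f i, g i)\<close> is the graph of an isometry, and completeness makes that isometry total.\<close>
lemma isometry_extension:
  fixes f :: "'i \<Rightarrow> 'a::complex_inner" and g :: "'i \<Rightarrow> 'b::chilbert_space"
  assumes dense: "closure (span (range f)) = UNIV"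
    and fg: "\<And>i j. cinner (f i) (f j) = cinner (g i) (g j)"
  shows "\<exists>F. bounded_clinear F \<and> (\<forall>i. F (f i) = g i)"
proof -
  define G0 where "G0 = span (range (\<lambda>i. (f i, g i)))"
  define G where "G = closure G0"
  have closed1: "closed {q. cinner (fst p) (fst q) = cinner (snd p) (snd q)}"
    and closed2: "closed {q. cinner (fst q) (fst p) = cinner (snd q) (snd p)}"
    for p :: "'a \<times> 'b"
    by (intro closed_Collect_eq cinner.continuous_on continuous_intros)+
  have sub1: "subspace {q. cinner (fst p) (fst q) = cinner (snd p) (snd q)}"
    and sub2: "subspace {q. cinner (fst q) (fst p) = cinner (snd q) (snd p)}"
    for p :: "'a \<times> 'b"
    by (simp_all add: subspace_def cinner.zero_left cinner.zero_right cinner_add_left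
        cinner_add_right cinner_scaleR_left cinner_scaleR_right)
  have G_le: "G \<subseteq> X" if "subspace X" "closed X" "\<And>i. (f i, g i) \<in> X" for X
    unfolding G_def G0_def using that by (intro closure_minimal span_minimal) auto
  \<comment> \<open>The identity is extended one slot at a time: first to all of \<open>G\<close>
    against a fixed generator, then to all of \<open>G\<close> against a fixed member of
    \<open>G\<close>.\<close>
  have "G \<subseteq> {q. cinner (f i) (fst q) = cinner (g i) (snd q)}" for i
    using G_le[OF sub1 closed1, of "(f i, g i)"] fg by simp
  then have "G \<subseteq> {q. cinner (fst q) (fst p) = cinner (snd q) (snd p)}" if "p \<in> G" for p
    using that by (intro G_le sub2 closed2) auto
  then have iso: "cinner (fst q) (fst p) = cinner (snd q) (snd p)" if "p \<in> G" "q \<in> G" for p q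
    using that by blast
  have subG: "subspace G" unfolding G_def G0_def by (intro subspace_closure subspace_span)
  have norm_iso: "norm a = norm b" if "(a, b) \<in> G" for a b
    using iso[OF that that] by (intro norm_eq_if_cinner_eq) simp
  have "span (range f) = fst ` G0"
  proof -
    have "range f = fst ` range (\<lambda>i. (f i, g i))" by (simp add: image_image)
    then show ?thesis unfolding G0_def by (simp add: linear_span_image[OF linear_fst])
  qed
  then have dom0: "\<exists>b. (a, b) \<in> G" if "a \<in> span (range f)" for a
    using that closure_subset[of G0] by (force simp: G_def)
  have dom: "\<exists>b. (a, b) \<in> G" for a
  proof -
    have "a \<in> closure (span (range f))" using dense by simp
    then obtain s where s: "\<And>n. s n \<in> span (range f)" "s \<longlonglongrightarrow> a"
      using closure_sequential by blast
    obtain t where t: "\<And>n. (s n, t n) \<in> G" using dom0[OF s(1)] by metis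
    have "norm (t m - t n) = norm (s m - s n)" for m n
      using subspace_diff[OF subG t[of m] t[of n]] norm_iso by force
    then have "Cauchy t"
      using LIMSEQ_imp_Cauchy[OF s(2)] by (simp add: Cauchy_def dist_norm)
    then obtain b where "t \<longlonglongrightarrow> b" using Cauchy_convergent convergent_def by blast
    then have "(\<lambda>n. (s n, t n)) \<longlonglongrightarrow> (a, b)" by (intro tendsto_Pair s)
    moreover have "closed G" by (simp add: G_def)
    ultimately have "(a, b) \<in> G" using closed_sequentially[of G "\<lambda>n. (s n, t n)"] t by simp
    then show ?thesis by blast
  qed
  then obtain F where F: "\<And>a. (a, F a) \<in> G" by metis
  \<comment> \<open>The graph is single-valued: the difference \<open>(0, F a - b)\<close> lies in
    \<open>G\<close>, so its second component has norm 0.\<close>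
  have FG: "F a = b" if "(a, b) \<in> G" for a b
    using norm_iso[of 0 "F a - b"] subspace_diff[OF subG F[of a] that] by simp
  have c: "F (c *\<^sub>C a) = c *\<^sub>C F a" for c a
  proof -
    have i: "cinner (F x) (F y) = cinner x y" for x y using iso[OF F[of y] F[of x]] by simp
    \<comment> \<open>\<open>G\<close> is built as a real span only; complex homogeneity follows
      from the preserved inner products by expanding the squared norm of the defect.\<close>
    have "cinner (F (c *\<^sub>C a) - c *\<^sub>C F a) (F (c *\<^sub>C a) - c *\<^sub>C F a) = 0"
      by (simp add: cinner.diff_left cinner.diff_right cinner_scaleC_left cinner_scaleC_right i)
    then show ?thesis by (simp add: cinner_eq_zero_iff)
  qed
  have "bounded_linear F"
  proof (rule bounded_linear_intro)
    show "F (x + y) = F x + F y" for x y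
      using subspace_add[OF subG F[of x] F[of y]] by (intro FG) simp
    show "F (r *\<^sub>R x) = r *\<^sub>R F x" for r x
      using subspace_scale[OF subG F[of x]] by (intro FG) simp
    show "norm (F x) \<le> norm x * 1" for x using norm_iso[OF F[of x]] by simp
  qed
  moreover have "F (f i) = g i" for i
    using closure_subset[of G0] by (intro FG) (auto simp: G_def G0_def intro: span_base)
  ultimately show ?thesis using c by (auto simp: bounded_clinear_def)
qed

lemma bounded_linear_eq_on_dense_span:
  fixes A B :: "'a::real_normed_vector \<Rightarrow> 'b::real_normed_vector"
  assumes "bounded_linear A" "bounded_linear B" "closure (span X) = UNIV"
    and "\<And>x. x \<in> X \<Longrightarrow> A x = B x"
  shows "A = B"
proof -
  have "span X \<subseteq> {x. A x = B x}"
    using linear_eq_on_span[OF bounded_linear.linear bounded_linear.linear, OF assms(1,2)] assms(4)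
    by blast
  moreover have "closed {x. A x = B x}"
    by (intro closed_Collect_eq linear_continuous_on assms)
  ultimately have "closure (span X) \<subseteq> {x. A x = B x}" by (rule closure_minimal)
  with assms(3) show ?thesis by auto
qed

text \<open>The inner product of pure tensors factorizes, so norms multiply and 1 is a bound. This
  supplies the continuity of matrix elements in each tensor factor.\<close>

lemma hilbert_tensor_bounded_bilinear:
  assumes "hilbert_tensor tens"
  shows "bounded_bilinear tens"
proof -
  have n: "norm (tens x y) = norm x * norm y" for x y
  proof -
    have "cinner (tens x y) (tens x y) = cinner x x * cinner y y"
      using assms by (simp add: hilbert_tensor_def)
    then have "complex_of_real ((norm (tens x y))\<^sup>2) = complex_of_real ((norm x * norm y)\<^sup>2)"
      by (simp add: cinner_self power_mult_distrib)
    then have "(norm (tens x y))\<^sup>2 = (norm x * norm y)\<^sup>2" using of_real_eq_iff by blast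
    then show ?thesis by (rule power2_eq_imp_eq) simp_all
  qed
  show ?thesis
    using assms unfolding hilbert_tensor_def
    by unfold_locales (auto simp: scaleC_of_real[symmetric] n intro!: exI[of _ 1])
qed

lemma hilbert_tensor_ext:
  assumes "hilbert_tensor tens" "bounded_clinear A" "bounded_clinear B"
    and "\<And>v w. A (tens v w) = B (tens v w)"
  shows "A = B"
  by (rule bounded_linear_eq_on_dense_span[of _ _ "range (\<lambda>(x, y). tens x y)"])
    (use assms in \<open>auto simp: hilbert_tensor_def bounded_clinear_def\<close>)

text \<open>Density of the pure tensors is used twice: first for the left vector of the matrix
  element, then for the argument of the operator.\<close>

lemma hilbert_tensor_form_ext:
  assumes "hilbert_tensor tens" "bounded_clinear A" "bounded_clinear B"
    and eq: "\<And>v w x y. cinner (tens v w) (A (tens x y)) = cinner (tens v w) (B (tens x y))"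
  shows "A = B"
proof (rule hilbert_tensor_ext[OF assms(1-3)])
  fix x y
  have "(\<lambda>u. cinner u (A (tens x y))) = (\<lambda>u. cinner u (B (tens x y)))"
  proof (rule bounded_linear_eq_on_dense_span)
    show "closure (span (range (\<lambda>(x, y). tens x y))) = UNIV"
      using assms(1) by (simp add: hilbert_tensor_def)
    show "cinner u (A (tens x y)) = cinner u (B (tens x y))" if "u \<in> range (\<lambda>(x, y). tens x y)" for u
      using that eq by (elim imageE) (simp only: case_prod_unfold)
  qed (rule cinner.bounded_linear_left)+
  from fun_cong[OF this] show "A (tens x y) = B (tens x y)"
    by (rule cinner_eq_right)
qed

section \<open>Well-definedness of the flip and of the operator-valued integral\<close>

lemma flip_works:
  assumes "hilbert_tensor tens"
  shows "bounded_clinear (flip tens)" "flip tens (tens v w) = tens w v"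
proof -
  \<comment> \<open>Swapping the factors of pure tensors preserves their inner products, since the
    two complex factors commute.\<close>
  have "\<exists>F. bounded_clinear F \<and> (\<forall>p. F ((\<lambda>(x, y). tens x y) p) = (\<lambda>(x, y). tens y x) p)"
    by (rule isometry_extension)
      (use assms in \<open>auto simp: hilbert_tensor_def mult.commute\<close>)
  then obtain F where F: "bounded_clinear F" "\<And>v w. F (tens v w) = tens w v" by auto
  have "\<exists>!F. bounded_clinear F \<and> (\<forall>v w. F (tens v w) = tens w v)"
    by (rule ex1I[of _ F]) (use F in \<open>auto intro!: hilbert_tensor_ext[OF assms]\<close>)
  from theI'[OF this] show "bounded_clinear (flip tens)" "flip tens (tens v w) = tens w v"
    unfolding flip_def by blast+
qed

lemma pvm_integral_works:
  assumes "hilbert_tensor tens" "pvm_integrable tens E A"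
  shows "bounded_clinear (pvm_integral tens E A)"
    "cinner (tens v w) (pvm_integral tens E A (tens x y)) =
      polarized_integral E v x (\<lambda>l. cinner w (A l y))"
proof -
  let ?P = "\<lambda>T. bounded_clinear T \<and> (\<exists>\<sigma>. bounded_sesquilinear \<sigma> \<and>
    extends_tensor_form tens E A \<sigma> \<and> (\<forall>x y. \<sigma> x y = cinner x (T y)))"
  obtain \<sigma> where \<sigma>: "bounded_sesquilinear \<sigma>" "extends_tensor_form tens E A \<sigma>"
    using assms(2) by (auto simp: pvm_integrable_def)
  obtain T where T: "bounded_clinear T" "\<And>x y. \<sigma> x y = cinner x (T y)"
    using bounded_sesquilinear_representation[OF \<sigma>(1)] by blast
  have form: "cinner (tens v w) (T (tens x y)) = polarized_integral E v x (\<lambda>l. cinner w (A l y))"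
    if "?P T" for T v w x y
    using that by (metis extends_tensor_form_def)
  \<comment> \<open>Different forms \<sigma> may be chosen for different candidates, but all give
    the same matrix elements between pure tensors, and these fix the operator.\<close>
  have "\<exists>!T. ?P T"
  proof (rule ex1I)
    show "?P T" using \<sigma> T by blast
    show "T' = T" if "?P T'" for T'
      by (rule hilbert_tensor_form_ext[OF assms(1)])
        (use that T(1) form[OF \<open>?P T\<close>] form[OF that] in auto)
  qed
  then have "?P (pvm_integral tens E A)"
    unfolding pvm_integral_def by (rule theI')
  then show "bounded_clinear (pvm_integral tens E A)"
    "cinner (tens v w) (pvm_integral tens E A (tens x y)) =
      polarized_integral E v x (\<lambda>l. cinner w (A l y))"
    using form by blast+
qed

section \<open>Standard subspaces\<close>

text \<open>Two decompositions of one vector differ by an element of \<open>H\<close> that also lies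
  in \<open>\<i>\<close> times \<open>H\<close>, hence by zero; so the description in
  \<open>tomita\<close> has a single candidate.\<close>

lemma tomita_eq:
  assumes H: "standard_subspace H" and hk: "h \<in> H" "k \<in> H"
  shows "tomita H (h + \<i> *\<^sub>C k) = h - \<i> *\<^sub>C k"
  unfolding tomita_def
proof (rule the_equality)
  fix w assume "\<exists>h'\<in>H. \<exists>k'\<in>H. h + \<i> *\<^sub>C k = h' + \<i> *\<^sub>C k' \<and> w = h' - \<i> *\<^sub>C k'"
  then obtain h' k' where w: "h' \<in> H" "k' \<in> H" "h + \<i> *\<^sub>C k = h' + \<i> *\<^sub>C k'" "w = h' - \<i> *\<^sub>C k'"
    by blast
  have s: "subspace H" and triv: "H \<inter> (\<lambda>h. \<i> *\<^sub>C h) ` H = {0}"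
    using H by (simp_all add: standard_subspace_def)
  have e: "h - h' = \<i> *\<^sub>C (k' - k)"
    using w(3) by (simp add: scaleC_diff_right algebra_simps)
  moreover have "h - h' \<in> H" "k' - k \<in> H" using w hk s by (auto intro: subspace_diff)
  ultimately have "h - h' = 0" using triv by blast
  with e w(3,4) show "w = h - \<i> *\<^sub>C k" by (simp add: scaleC_diff_right)
qed (use hk in blast)

lemma tomita_closed:
  assumes H: "standard_subspace H" and v: "v \<in> complex_sum H"
  shows "tomita H v \<in> complex_sum H" "tomita H (tomita H v) = v"
proof -
  obtain h k where v: "v = h + \<i> *\<^sub>C k" and hk: "h \<in> H" "k \<in> H"
    using v by (auto simp: complex_sum_def)
  have k': "- k \<in> H" using H hk(2) by (simp add: standard_subspace_def subspace_neg)
  have e: "tomita H v = h + \<i> *\<^sub>C (- k)"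
    by (simp add: v tomita_eq[OF H hk] scaleC_minus_right)
  show "tomita H v \<in> complex_sum H" unfolding e using hk(1) k' by (auto simp: complex_sum_def)
  show "tomita H (tomita H v) = v"
    unfolding e tomita_eq[OF H hk(1) k'] by (simp add: v scaleC_minus_right)
qed

text \<open>By complex linearity \<open>V h + \<i> *\<^sub>C V k\<close> is the decomposition of the
  image of \<open>h + \<i> *\<^sub>C k\<close>, because \<open>V h\<close> and \<open>V k\<close>
  are again in \<open>H\<close>.\<close>

lemma tomita_commute:
  assumes H: "standard_subspace H" and V: "V \<in> subspace_endos H" and v: "v \<in> complex_sum H"
  shows "V v \<in> complex_sum H" "V (tomita H v) = tomita H (V v)"
proof -
  obtain h k where v: "v = h + \<i> *\<^sub>C k" and hk: "h \<in> H" "k \<in> H"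
    using v by (auto simp: complex_sum_def)
  have Vhk: "V h \<in> H" "V k \<in> H" using V hk by (auto simp: subspace_endos_def)
  have lin: "V (x + y) = V x + V y" "V (x - y) = V x - V y" "V (c *\<^sub>C x) = c *\<^sub>C V x" for x y c
    using V by (auto simp: subspace_endos_def bounded_clinear_def linear_add linear_diff
        dest: bounded_linear.linear)
  show "V v \<in> complex_sum H" using Vhk by (auto simp: v lin complex_sum_def)
  show "V (tomita H v) = tomita H (V v)"
    by (simp add: v lin tomita_eq[OF H hk] tomita_eq[OF H Vhk])
qed

section \<open>The adjoint of the Tomita operator and its domain\<close>

lemma antilinear_adj_works:
  assumes D: "closure D = UNIV" and v: "v \<in> antilinear_adj_dom D S" and w: "w \<in> D"
  shows "cinner v (S w) = cinner w (antilinear_adj D S v)"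
proof -
  obtain u where u: "\<forall>w\<in>D. cinner v (S w) = cinner w u"
    using v by (auto simp: antilinear_adj_dom_def)
  have "\<exists>!u. \<forall>w\<in>D. cinner v (S w) = cinner w u"
  proof (rule ex1I)
    show "\<forall>w\<in>D. cinner v (S w) = cinner w u" by (rule u)
    fix u' assume u': "\<forall>w\<in>D. cinner v (S w) = cinner w u'"
    \<comment> \<open>Two candidates have equal inner products with the dense set \<open>D\<close>,
      and by continuity with every vector.\<close>
    have "D \<subseteq> {w. cinner w u' = cinner w u}"
      using u u' by (metis (mono_tags, lifting) mem_Collect_eq subsetI)
    then have "closure D \<subseteq> {w. cinner w u' = cinner w u}"
      by (rule closure_minimal) (intro closed_Collect_eq cinner.continuous_on continuous_intros)
    then have "cinner w u' = cinner w u" for w using D by auto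
    then show "u' = u" by (rule cinner_eq_right)
  qed
  from theI'[OF this] w show ?thesis unfolding antilinear_adj_def by blast
qed

text \<open>If \<open>u\<close> is the adjoint image of \<open>v\<close>, then
  \<open>cnj c *\<^sub>C u\<close> serves for \<open>c *\<^sub>C v\<close>: the adjoint is
  antilinear, but its domain is a complex subspace.\<close>

lemma antilinear_adj_dom_subspace:
  "subspace (antilinear_adj_dom D S)"
  "v \<in> antilinear_adj_dom D S \<Longrightarrow> c *\<^sub>C v \<in> antilinear_adj_dom D S"
proof -
  show c: "c *\<^sub>C v \<in> antilinear_adj_dom D S" if "v \<in> antilinear_adj_dom D S" for c v
  proof -
    obtain u where "\<forall>w\<in>D. cinner v (S w) = cinner w u"
      using \<open>v \<in> antilinear_adj_dom D S\<close> by (auto simp: antilinear_adj_dom_def)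
    then have "\<forall>w\<in>D. cinner (c *\<^sub>C v) (S w) = cinner w (cnj c *\<^sub>C u)"
      by (simp add: cinner_scaleC_left cinner_scaleC_right)
    then show ?thesis by (auto simp: antilinear_adj_dom_def)
  qed
  show "subspace (antilinear_adj_dom D S)"
  proof (rule subspaceI)
    show "0 \<in> antilinear_adj_dom D S"
      by (auto simp: antilinear_adj_dom_def cinner.zero_left cinner.zero_right intro!: exI[of _ 0])
    fix x y assume "x \<in> antilinear_adj_dom D S" "y \<in> antilinear_adj_dom D S"
    then obtain u u' where "\<forall>w\<in>D. cinner x (S w) = cinner w u" "\<forall>w\<in>D. cinner y (S w) = cinner w u'"
      by (auto simp: antilinear_adj_dom_def)
    then have "\<forall>w\<in>D. cinner (x + y) (S w) = cinner w (u + u')"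
      by (simp add: cinner_add_left cinner_add_right)
    then show "x + y \<in> antilinear_adj_dom D S" by (auto simp: antilinear_adj_dom_def)
  next
    fix r x assume "x \<in> antilinear_adj_dom D S"
    from c[OF this, of "complex_of_real r"] show "r *\<^sub>R x \<in> antilinear_adj_dom D S"
      by (simp add: scaleC_of_real)
  qed
qed

text \<open>The vectors \<open>v\<close> form the symplectic complement of \<open>H\<close>, which is \<open>\<i>\<close> times the real
  orthogonal complement of \<open>H\<close>.\<close>
lemma symplectic_complement_in_adj_dom:
  assumes H: "standard_subspace H" and v: "\<And>h. h \<in> H \<Longrightarrow> Im (cinner v h) = 0"
  shows "v \<in> antilinear_adj_dom (complex_sum H) (tomita H)"
proof -
  have comm: "cinner v h = cinner h v" if "h \<in> H" for h
    using v[OF that] by (subst (2) cinner_commute) (simp add: complex_eq_iff)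
  have "cinner v (tomita H w) = cinner w v" if w: "w \<in> complex_sum H" for w
  proof -
    obtain h k where w: "w = h + \<i> *\<^sub>C k" and hk: "h \<in> H" "k \<in> H"
      using w by (auto simp: complex_sum_def)
    show ?thesis
      unfolding w tomita_eq[OF H hk]
      by (simp add: cinner.diff_right cinner_add_left cinner_scaleC_left cinner_scaleC_right
          comm hk)
  qed
  then show ?thesis by (auto simp: antilinear_adj_dom_def)
qed

text \<open>Let \<open>x\<close> be orthogonal to the domain and \<open>p\<close> its real
  orthogonal projection onto \<open>H\<close>. Then \<open>\<i> *\<^sub>C (x - p)\<close> is in the
  symplectic complement of \<open>H\<close>, hence in the domain, so
  \<open>cinner x (x - p) = 0\<close>. With \<open>Re (cinner p (x - p)) = 0\<close> this gives
  \<open>x = p\<close>, so \<open>x\<close> is in \<open>H\<close>. As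
  \<open>\<i> *\<^sub>C x\<close> is orthogonal to the domain too, it is also in \<open>H\<close>,
  which forces \<open>x = 0\<close>.\<close>

lemma tomita_adj_dom_dense:
  assumes H: "standard_subspace H"
  shows "closure (antilinear_adj_dom (complex_sum H) (tomita H)) = UNIV"
proof (rule dense_if_orthogonal_trivial)
  let ?M = "antilinear_adj_dom (complex_sum H) (tomita H)"
  have s: "subspace H" "closed H" and triv: "H \<inter> (\<lambda>h. \<i> *\<^sub>C h) ` H = {0}"
    using H by (simp_all add: standard_subspace_def)
  have inH: "x \<in> H" if x: "\<And>m. m \<in> ?M \<Longrightarrow> cinner x m = 0" for x
  proof -
    obtain p where p: "p \<in> H" "\<And>h. h \<in> H \<Longrightarrow> Re (cinner (x - p) h) = 0"
      using real_orthogonal_projection[OF s] by blast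
    have "\<i> *\<^sub>C (x - p) \<in> ?M"
      by (rule symplectic_complement_in_adj_dom[OF H]) (simp add: cinner_scaleC_left p(2))
    from x[OF this] have 1: "cinner x (x - p) = 0" by (simp add: cinner_scaleC_right)
    have "Re (cinner p (x - p)) = 0"
      using p(2)[OF p(1)] by (subst cinner_commute) simp
    with 1 have "Re (cinner (x - p) (x - p)) = 0" by (simp add: cinner.diff_left[of x p "x - p"])
    then have "x = p" by (simp add: cinner_self)
    with p(1) show ?thesis by simp
  qed
  show "x = 0" if x: "\<And>m. m \<in> ?M \<Longrightarrow> cinner x m = 0" for x
  proof -
    have 1: "x \<in> H" using inH x by blast
    have "\<i> *\<^sub>C x \<in> H" using x by (intro inH) (simp add: cinner_scaleC_left)
    then have "- (\<i> *\<^sub>C x) \<in> H" by (rule subspace_neg[OF s(1)])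
    moreover have "x = \<i> *\<^sub>C (- (\<i> *\<^sub>C x))"
      by (simp add: scaleC_minus_right scaleC_scaleC scaleC_minus_one)
    ultimately have "x \<in> H \<inter> (\<lambda>h. \<i> *\<^sub>C h) ` H" using 1 by blast
    with triv show ?thesis by blast
  qed
qed (rule antilinear_adj_dom_subspace; assumption?)+

section \<open>Crossing symmetry\<close>

text \<open>The crossing relation fixes the matrix elements of \<open>C\<close> for vectors from the
  two dense domains. They are continuous in each of the four vectors separately, so the domain
  restrictions can be removed one vector at a time.\<close>

lemma is_crossing_unique:
  fixes tens :: "'a::chilbert_space \<Rightarrow> 'a \<Rightarrow> 'b::chilbert_space"
  assumes t: "hilbert_tensor tens" and D: "closure D = UNIV"
    and D': "closure (antilinear_adj_dom D S) = UNIV"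
    and C: "is_crossing tens D S T C" and C': "is_crossing tens D S T C'"
  shows "C = C'"
proof -
  let ?D' = "antilinear_adj_dom D S"
  have bC: "bounded_clinear C" "bounded_clinear C'" using C C' by (simp_all add: is_crossing_def)
  define f where "f A v w x y = cinner (tens v w) (A (tens x y))"
    for A :: "'b \<Rightarrow> 'b" and v w x y
  note bt = bounded_bilinear.continuous_on[OF hilbert_tensor_bounded_bilinear[OF t]]
  note defs = f_def bounded_clinear_def
  have c: "continuous_on UNIV (\<lambda>v. f A v w x y)" "continuous_on UNIV (\<lambda>w. f A v w x y)"
    "continuous_on UNIV (\<lambda>x. f A v w x y)" "continuous_on UNIV (\<lambda>y. f A v w x y)"
    if "bounded_clinear A" for A v w x y
    using that unfolding defs
    by (intro cinner.continuous_on bt continuous_on_id continuous_on_const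
        bounded_linear.continuous_on[of A]; simp)+
  have dense_eq: "P u = Q u"
    if "closure X = UNIV" "continuous_on UNIV P" "continuous_on UNIV Q" "\<And>u. u \<in> X \<Longrightarrow> P u = Q u"
    for X :: "'a set" and P Q :: "'a \<Rightarrow> complex" and u
  proof -
    have "closure X \<subseteq> {u. P u = Q u}"
      using that by (intro closure_minimal closed_Collect_eq) auto
    with that(1) show ?thesis by auto
  qed
  have 1: "f C v w x y = f C' v w x y" if "v \<in> D" "x \<in> D" "w \<in> ?D'" "y \<in> ?D'" for v w x y
    using C C' that unfolding is_crossing_def f_def by metis
  have 2: "f C v w x y = f C' v w x y" if "v \<in> D" "x \<in> D" "w \<in> ?D'" for v w x y
    by (rule dense_eq[OF D' c(4)[OF bC(1)] c(4)[OF bC(2)]]) (rule 1[OF that])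
  have 3: "f C v w x y = f C' v w x y" if "v \<in> D" "x \<in> D" for v w x y
    by (rule dense_eq[OF D' c(2)[OF bC(1)] c(2)[OF bC(2)]]) (rule 2[OF that])
  have 4: "f C v w x y = f C' v w x y" if "v \<in> D" for v w x y
    by (rule dense_eq[OF D c(3)[OF bC(1)] c(3)[OF bC(2)]]) (rule 3[OF that])
  have "f C v w x y = f C' v w x y" for v w x y
    by (rule dense_eq[OF D c(1)[OF bC(1)] c(1)[OF bC(2)]]) (rule 4)
  then show ?thesis
    by (intro hilbert_tensor_form_ext[OF t bC]) (simp add: f_def)
qed

section \<open>Symmetries of the polarized integral\<close>

lemma pvm_measure_scaleC:
  assumes E: "projection_valued_measure E" and c: "cmod c = 1"
  shows "pvm_measure E (c *\<^sub>C \<psi>) = pvm_measure E \<psi>"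
  unfolding pvm_measure_def
\<comment> \<open>It suffices to compare the two set functions on Borel sets, where the phase
  \<open>c\<close> cancels against its conjugate.\<close>
proof (rule measure_of_eq)
  fix B :: "real set" assume "B \<in> sigma_sets UNIV (sets borel)"
  then have "B \<in> sets borel" using sets.sigma_sets_eq[of "borel :: real measure"] by simp
  then have "E B (c *\<^sub>C \<psi>) = c *\<^sub>C E B \<psi>"
    using E by (simp add: projection_valued_measure_def orthogonal_projection_def bounded_clinear_def)
  moreover have "c * cnj c = 1"
    using c complex_norm_square[of c] by simp
  ultimately have "cinner (c *\<^sub>C \<psi>) (E B (c *\<^sub>C \<psi>)) = cinner \<psi> (E B \<psi>)"
    by (simp add: cinner_scaleC_left cinner_scaleC_right mult.assoc[symmetric])
  then show "ennreal (Re (cinner (c *\<^sub>C \<psi>) (E B (c *\<^sub>C \<psi>)))) = ennreal (Re (cinner \<psi> (E B \<psi>)))"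
    by simp
qed simp

text \<open>Under conjugation the fourth root of unity \<open>\<i> ^ k\<close> in the polarization formula becomes
  its inverse, and \<open>\<psi> + \<i> ^ k *\<^sub>C \<phi>\<close> is a unimodular multiple of
  \<open>\<phi> + inverse (\<i> ^ k) *\<^sub>C \<psi>\<close>.\<close>
lemma polarized_integral_cnj:
  assumes E: "projection_valued_measure E"
  shows "polarized_integral E \<phi> \<psi> (\<lambda>x. cnj (f x)) = cnj (polarized_integral E \<psi> \<phi> f)"
proof -
  have m: "pvm_measure E (\<psi> + c *\<^sub>C \<phi>) = pvm_measure E (\<phi> + cnj c *\<^sub>C \<psi>)" if c: "cmod c = 1" for c
  proof -
    have "c * cnj c = 1" using c complex_norm_square[of c] by simp
    then have "\<psi> + c *\<^sub>C \<phi> = c *\<^sub>C (\<phi> + cnj c *\<^sub>C \<psi>)"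
      by (simp add: scaleC_add_right scaleC_scaleC add.commute)
    then show ?thesis using pvm_measure_scaleC[OF E c] by metis
  qed
  \<comment> \<open>This holds for every \<open>f\<close>: without integrability both integrals have
    the default value 0.\<close>
  have int: "(LINT x:X|M. cnj (f x)) = cnj (LINT x:X|M. f x)" for X and M :: "real measure"
    unfolding set_lebesgue_integral_def Bochner_Integration.integral_cnj[symmetric] by simp
  have 3: "\<i> ^ 3 = - \<i>" by (simp add: power3_eq_cube)
  have "{..<4::nat} = {0, 1, 2, 3}" by auto
  \<comment> \<open>Conjugation exchanges the summands for \<open>k = 1\<close> and
    \<open>k = 3\<close> and matches those for \<open>k = 0\<close> and \<open>k = 2\<close> with
    themselves.\<close>
  then show ?thesis
    unfolding polarized_integral_def
    using m[of 1] m[of "\<i>"] m[of "-1"] m[of "-\<i>"] by (simp add: int 3)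
qed

text \<open>The indicator of the support removes all other values. Identities for \<open>V l\<close>
  are available only for \<open>l\<close> in the support, and this lets them be used under the
  integral.\<close>

lemma polarized_integral_cong:
  assumes "\<And>x. x \<in> pvm_support E \<Longrightarrow> f x = g x"
  shows "polarized_integral E \<phi> \<psi> f = polarized_integral E \<phi> \<psi> g"
proof -
  have "indicator (pvm_support E) x *\<^sub>R f x = indicator (pvm_support E) x *\<^sub>R g x" for x
    using assms by (cases "x \<in> pvm_support E") simp_all
  then show ?thesis by (simp only: polarized_integral_def set_lebesgue_integral_def)
qed

theorem proposition4p6:
  fixes tens :: "'a::chilbert_space \<Rightarrow> 'a \<Rightarrow> 'c::chilbert_space"
    and H :: "'a set"
    and E :: "real set \<Rightarrow> 'a \<Rightarrow> 'a"
    and V :: "real \<Rightarrow> 'a \<Rightarrow> 'a"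
  assumes "separable_space (euclidean :: 'a topology)"
    and "hilbert_tensor tens"
    and "standard_subspace H"
    and "projection_valued_measure E"
    and "V \<in> pvm_support E \<rightarrow> subspace_endos H"
    and "pvm_integrable tens E V"
  shows "crossing_symmetric tens (complex_sum H) (tomita H) (pvm_integral tens E V \<circ> flip tens)"
proof -
  let ?D = "complex_sum H" and ?S = "tomita H"
  let ?D' = "antilinear_adj_dom ?D ?S" and ?S' = "antilinear_adj ?D ?S"
  let ?I = "pvm_integral tens E V"
  let ?T = "?I \<circ> flip tens"
  note t = assms(2) and H = assms(3) and E = assms(4)
  note I = pvm_integral_works[OF t assms(6)] and F = flip_works[OF t]
  have D: "closure ?D = UNIV" using H by (simp add: standard_subspace_def)
  have T: "bounded_clinear ?T" by (rule bounded_clinear_compose[OF I(1) F(1)])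
  have "is_crossing tens ?D ?S ?T (cadjoint ?T)"
    unfolding is_crossing_def
  proof (intro conjI ballI)
    show "bounded_clinear (cadjoint ?T)" by (rule cadjoint_works[OF T])
    fix \<phi>1 \<psi>1 \<phi>2 \<psi>2
    assume \<phi>1: "\<phi>1 \<in> ?D" and "\<psi>1 \<in> ?D" "\<phi>2 \<in> ?D'" and \<psi>2: "\<psi>2 \<in> ?D'"
    have key: "cinner (?S' \<psi>2) (V l (?S \<phi>1)) = cnj (cinner \<psi>2 (V l \<phi>1))"
      if l: "l \<in> pvm_support E" for l
    proof -
      have Vl: "V l \<in> subspace_endos H" using assms(5) l by blast
      define u where "u = V l \<phi>1"
      have u: "u \<in> ?D" unfolding u_def by (rule tomita_commute[OF H Vl \<phi>1])
      have "cinner (?S' \<psi>2) (V l (?S \<phi>1)) = cnj (cinner (?S u) (?S' \<psi>2))"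
        unfolding u_def tomita_commute(2)[OF H Vl \<phi>1] by (rule cinner_commute)
      \<comment> \<open>The defining relation of the adjoint is applied to \<open>?S u\<close> in
        place of \<open>u\<close>, and the involution gives \<open>?S (?S u) = u\<close>.\<close>
      also have "cinner (?S u) (?S' \<psi>2) = cinner \<psi>2 u"
        using antilinear_adj_works[OF D \<psi>2 tomita_closed(1)[OF H u]] tomita_closed(2)[OF H u]
        by simp
      finally show ?thesis by (simp add: u_def)
    qed
    \<comment> \<open>The flip moves \<open>?S \<phi>1\<close> into the second factor, where
      \<open>V l\<close> acts; the projections then act between \<phi>2 and \<psi>1.\<close>
    have "cinner (tens \<phi>2 (?S' \<psi>2)) (?T (tens (?S \<phi>1) \<psi>1)) =
        polarized_integral E \<phi>2 \<psi>1 (\<lambda>l. cinner (?S' \<psi>2) (V l (?S \<phi>1)))"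
      by (simp add: F I)
    also have "\<dots> = polarized_integral E \<phi>2 \<psi>1 (\<lambda>l. cnj (cinner \<psi>2 (V l \<phi>1)))"
      by (rule polarized_integral_cong) (rule key)
    \<comment> \<open>Conjugation exchanges \<phi>2 and \<psi>1 in the integral, which becomes the
      matrix element of \<open>?I\<close> at \<open>tens \<phi>2 \<phi>1\<close>, the flip of
      \<open>tens \<phi>1 \<phi>2\<close>.\<close>
    also have "\<dots> = cnj (cinner (tens \<psi>1 \<psi>2) (?T (tens \<phi>1 \<phi>2)))"
      by (simp add: polarized_integral_cnj[OF E] F I)
    also have "\<dots> = cinner (tens \<phi>1 \<phi>2) (cadjoint ?T (tens \<psi>1 \<psi>2))"
      unfolding cadjoint_works(2)[OF T] by (rule cinner_commute[symmetric])
    finally show "cinner (tens \<phi>2 (?S' \<psi>2)) (?T (tens (?S \<phi>1) \<psi>1)) =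
        cinner (tens \<phi>1 \<phi>2) (cadjoint ?T (tens \<psi>1 \<psi>2))" .
  qed
  \<comment> \<open>With uniqueness the crossing relation singles out the adjoint, which settles
    both crossability and the value of \<open>crossing_map\<close>.\<close>
  then have crossing: "is_crossing tens ?D ?S ?T C \<longleftrightarrow> C = cadjoint ?T" for C
    using is_crossing_unique[OF t D tomita_adj_dom_dense[OF H]] by metis
  show ?thesis
    unfolding crossing_symmetric_def crossable_def crossing_map_def crossing using T by simp
qed

end
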